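(* Let $n\geq 2$ and $0\leq k\leq n/2$ be integers, and let $x_I=x_{i_1}x_{i_2}\cdots x_{i_k}$ be a squarefree monomial of degree $k$ in $x_1,\dots,x_n$. If the label $\mu(x_I)$ is a reverse lattice word, then $x_I$ is a linear combination of elements of $\mathcal{B}_{n,k}$ whose coefficients are nonnegative integer multiples of $1/2^k$.
   Context: The label $\mu(x_I)$ is the word of length $n$ over $\{1,2\}$ with $\mu(x_I)_j=2$ iff $x_j$ divides $x_I$; it is a reverse lattice word if every terminal segment contains at least as many 1s as 2s. $V_{n,k}$ is the $\mathbb{Q}$-vector space with basis the squarefree degree-$k$ monomials in $x_1,\dots,x_n$. Monomials are ordered lexicographically: for distinct $k$-subsets $I,J$ with $t=\min(I\,\Delta\,J)$, $x_I\prec x_J$ iff $t\in I$. A nonzero $v\in V_{n,k}$ is positive if the $\prec$-minimal monomial in $v$ has positive coefficient. A $k$-root is a product $\prod_{r=1}^k(\pm x_{i_{2r-1}}\pm x_{i_{2r}})$ with independent signs and $2k$ distinct indices; it is positive if positive in $V_{n,k}$. Each positive $k$-root can be written uniquely up to order of factors as $\prod_{r=1}^k(x_{i_{2r-1}}\pm x_{i_{2r}})$ with $i_{2r-1}<i_{2r}$ (normal form); factors $(x_i+x_j)$ are symmetric, indices not appearing are unused. A positive $k$-root has a defect if its normal form has, for some $i<j<r<s$: (i) factors $(x_i\pm x_r)$ and $(x_j\pm x_s)$; (ii) a factor $(x_i\pm x_s)$ and a symmetric factor $(x_j+x_r)$; (iii) a factor $(x_i\pm x_r)$ and an unused index $j$;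 or (iv) a symmetric factor $(x_i+x_j)$ and an unused index $r$. $\mathcal{B}_{n,k}$ is the set of positive $k$-roots with no defects (a basis of $V_{n,k}$). *)

theory Defs
  imports "HOL-Library.Poly_Mapping" "HOL-Library.Sublist" Complex_Main
begin

(* Polynomials over the rationals in the variables x_0, x_1, x_2, ...: finitely supported
   families of coefficients, indexed by exponent vectors, with the convolution product of
   Poly_Mapping. Only x_1, ..., x_n are used below. *)
type_synonym rpoly = "(nat \<Rightarrow>\<^sub>0 nat) \<Rightarrow>\<^sub>0 rat"

definition const :: "rat \<Rightarrow> rpoly" where
  "const c = Poly_Mapping.single 0 c"

definition X :: "nat \<Rightarrow> rpoly" where
  "X i = Poly_Mapping.single (Poly_Mapping.single i 1) 1"

definition ksubsets :: "nat \<Rightarrow> nat \<Rightarrow> nat set set" where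
  "ksubsets n k = {I. I \<subseteq> {1..n} \<and> card I = k}"

definition xmon :: "nat set \<Rightarrow> rpoly" where
  "xmon I = (\<Prod>i\<in>I. X i)"

(* The exponent vector of xmon I, so that lookup v (expo I) is the coefficient of xmon I in v. *)
definition expo :: "nat set \<Rightarrow> (nat \<Rightarrow>\<^sub>0 nat)" where
  "expo I = (\<Sum>i\<in>I. Poly_Mapping.single i 1)"

definition V :: "nat \<Rightarrow> nat \<Rightarrow> rpoly set" where
  "V n k = {v. Poly_Mapping.keys v \<subseteq> expo ` ksubsets n k}"

definition mon_less :: "nat set \<Rightarrow> nat set \<Rightarrow> bool" where
  "mon_less I J \<longleftrightarrow> I \<noteq> J \<and> Min ((I - J) \<union> (J - I)) \<in> I"

definition positive :: "nat \<Rightarrow> nat \<Rightarrow> rpoly \<Rightarrow> bool" where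
  "positive n k v \<longleftrightarrow> v \<in> V n k \<and> v \<noteq> 0 \<and>
     (\<exists>I\<in>ksubsets n k. Poly_Mapping.lookup v (expo I) > 0 \<and>
        (\<forall>J\<in>ksubsets n k. Poly_Mapping.lookup v (expo J) \<noteq> 0 \<and> J \<noteq> I \<longrightarrow> mon_less I J))"

definition kroot :: "nat \<Rightarrow> nat \<Rightarrow> rpoly \<Rightarrow> bool" where
  "kroot n k v \<longleftrightarrow>
     (\<exists>(i :: nat \<Rightarrow> nat) (e :: nat \<Rightarrow> rpoly).
        inj_on i {1..2 * k} \<and> i ` {1..2 * k} \<subseteq> {1..n} \<and> (\<forall>m\<in>{1..2 * k}. e m \<in> {1, - 1}) \<and>
        v = (\<Prod>r = 1..k. e (2 * r - 1) * X (i (2 * r - 1)) + e (2 * r) * X (i (2 * r))))"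

(* A triple (i, j, True) stands for the symmetric factor x_i + x_j, and (i, j, False) for x_i - x_j. *)
type_synonym nfactor = "nat \<times> nat \<times> bool"

fun factor_poly :: "nfactor \<Rightarrow> rpoly" where
  "factor_poly (i, j, s) = (if s then X i + X j else X i - X j)"

fun factor_indices :: "nfactor \<Rightarrow> nat set" where
  "factor_indices (i, j, s) = {i, j}"

(* F is the set of factors of the normal form of v; being a set, it disregards their order. *)
definition normal_form :: "nat \<Rightarrow> nat \<Rightarrow> nfactor set \<Rightarrow> rpoly \<Rightarrow> bool" where
  "normal_form n k F v \<longleftrightarrow> finite F \<and> card F = k \<and>
     (\<forall>(i, j, s)\<in>F. 1 \<le> i \<and> i < j \<and> j \<le> n) \<and>
     (\<forall>f\<in>F. \<forall>g\<in>F. f \<noteq> g \<longrightarrow> factor_indices f \<inter> factor_indices g = {}) \<and>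
     v = (\<Prod>f\<in>F. factor_poly f)"

definition unused :: "nat \<Rightarrow> nfactor set \<Rightarrow> nat set" where
  "unused n F = {1..n} - (\<Union>f\<in>F. factor_indices f)"

(* In the last two disjuncts only the three indices that occur are required to exist: no
   fourth index s > r is asked for. *)
definition nf_defect :: "nat \<Rightarrow> nfactor set \<Rightarrow> bool" where
  "nf_defect n F \<longleftrightarrow>
     (\<exists>i j r s a b. i < j \<and> j < r \<and> r < s \<and> (i, r, a) \<in> F \<and> (j, s, b) \<in> F) \<or>
     (\<exists>i j r s a. i < j \<and> j < r \<and> r < s \<and> (i, s, a) \<in> F \<and> (j, r, True) \<in> F) \<or>
     (\<exists>i j r a. i < j \<and> j < r \<and> (i, r, a) \<in> F \<and> j \<in> unused n F) \<or>
     (\<exists>i j r. i < j \<and> j < r \<and> (i, j, True) \<in> F \<and> r \<in> unused n F)"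

definition has_defect :: "nat \<Rightarrow> nat \<Rightarrow> rpoly \<Rightarrow> bool" where
  "has_defect n k v \<longleftrightarrow> (\<exists>F. normal_form n k F v \<and> nf_defect n F)"

definition B :: "nat \<Rightarrow> nat \<Rightarrow> rpoly set" where
  "B n k = {v. kroot n k v \<and> positive n k v \<and> \<not> has_defect n k v}"

definition label :: "nat \<Rightarrow> rpoly \<Rightarrow> nat list" where
  "label n m = map (\<lambda>j. if X j dvd m then 2 else 1) [1..<n + 1]"

definition reverse_lattice_word :: "nat list \<Rightarrow> bool" where
  "reverse_lattice_word w \<longleftrightarrow> (\<forall>u. suffix u w \<longrightarrow> count_list u 2 \<le> count_list u 1)"

end

theory Submission
  imports Defs "HOL-Library.FuncSet"
begin

text \<open>The reverse lattice condition lets every \<open>i \<in> I\<close> be matched with some \<open>m i > i\<close> outside \<open>I\<close>,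
  injectively. Multiplying out \<open>2 X i = (X i + X (m i)) + (X i - X (m i))\<close> over \<open>i \<in> I\<close> writes \<open>2\<^sup>k xmon I\<close> as a
  sum of positive \<open>k\<close>-roots. Each defect of a positive \<open>k\<close>-root is resolved by an identity with
  nonnegative coefficients, for instance \<open>(i - r)(j - s) = (i - j)(r - s) + (i - s)(j - r)\<close>, whose
  terms are again positive \<open>k\<close>-roots. As these rewritings terminate, every positive \<open>k\<close>-root is a
  nonnegative integer combination of \<open>B n k\<close>. A normal form is determined by its product, so it has
  a defect as soon as the product does.\<close>


section \<open>Normal forms as sets of factors\<close>

abbreviation lo :: "nfactor \<Rightarrow> nat" where "lo f \<equiv> fst f"
abbreviation hi :: "nfactor \<Rightarrow> nat" where "hi f \<equiv> fst (snd f)"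
abbreviation symm :: "nfactor \<Rightarrow> bool" where "symm f \<equiv> snd (snd f)"

abbreviation indices :: "nfactor set \<Rightarrow> nat set" where
  "indices F \<equiv> (\<Union>f\<in>F. factor_indices f)"

abbreviation poly_of :: "nfactor set \<Rightarrow> rpoly" where
  "poly_of F \<equiv> (\<Prod>f\<in>F. factor_poly f)"

text \<open>Separating the conditions on \<open>F\<close> from \<open>k\<close> and the product lets
  the rewriting below speak of factor sets alone.\<close>

definition nform :: "nat \<Rightarrow> nfactor set \<Rightarrow> bool" where
  "nform n F \<longleftrightarrow> finite F \<and> (\<forall>f\<in>F. 1 \<le> lo f \<and> lo f < hi f \<and> hi f \<le> n) \<and>
     (\<forall>f\<in>F. \<forall>g\<in>F. f \<noteq> g \<longrightarrow> factor_indices f \<inter> factor_indices g = {})"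

lemma normal_form_iff: "normal_form n k F v \<longleftrightarrow> nform n F \<and> card F = k \<and> v = poly_of F"
  unfolding normal_form_def nform_def by (auto simp: case_prod_beta)

lemma nformD:
  assumes "nform n F"
  shows "finite F" "f \<in> F \<Longrightarrow> 1 \<le> lo f" "f \<in> F \<Longrightarrow> lo f < hi f" "f \<in> F \<Longrightarrow> hi f \<le> n"
    "f \<in> F \<Longrightarrow> g \<in> F \<Longrightarrow> x \<in> factor_indices f \<Longrightarrow> x \<in> factor_indices g \<Longrightarrow> f = g"
  using assms unfolding nform_def by blast+

lemma factor_indices_eq: "factor_indices f = {lo f, hi f}"
  by (cases f) auto

definition fsign :: "nfactor \<Rightarrow> rat" where
  "fsign f = (if symm f then 1 else - 1)"

text \<open>The monomials of \<open>poly_of F\<close> correspond to the sets \<open>S \<subseteq> F\<close> of those factors that contribute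
  their right-hand variable.\<close>

definition pick :: "nfactor set \<Rightarrow> nfactor \<Rightarrow> nat" where
  "pick S f = (if f \<in> S then hi f else lo f)"

lemma pick_in: "pick S f \<in> factor_indices f"
  by (auto simp: pick_def factor_indices_eq)

lemma inj_on_pick: "nform n F \<Longrightarrow> inj_on (pick S) F"
  by (rule inj_onI) (metis nformD(5) pick_in)

text \<open>An endpoint of \<open>f\<close> lies in no other factor, so it can enter the image only
  through the choice made at \<open>f\<close>. Hence \<open>S\<close> can be read off from the
  monomial.\<close>

lemma pick_image_in_iff:
  assumes "nform n F" "f \<in> F"
  shows "lo f \<in> pick S ` F \<longleftrightarrow> f \<notin> S" "hi f \<in> pick S ` F \<longleftrightarrow> f \<in> S"
proof -
  have ne: "lo f \<noteq> hi f" using nformD(3)[OF assms] by simp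
  have *: "g = f" if "g \<in> F" "pick S g \<in> factor_indices f" for g
    using nformD(5)[OF assms(1) that(1) assms(2)] that(2) pick_in by blast
  have "x \<in> pick S ` F \<longleftrightarrow> pick S f = x" if "x \<in> factor_indices f" for x
    using * assms(2) that by auto
  then show "lo f \<in> pick S ` F \<longleftrightarrow> f \<notin> S" "hi f \<in> pick S ` F \<longleftrightarrow> f \<in> S"
    using ne by (simp_all add: factor_indices_eq pick_def)
qed

lemma inj_on_pick_image:
  assumes "nform n F"
  shows "inj_on (\<lambda>S. pick S ` F) (Pow F)"
proof (rule inj_onI)
  fix S T assume "S \<in> Pow F" "T \<in> Pow F" "pick S ` F = pick T ` F"
  then show "S = T" using pick_image_in_iff(2)[OF assms] by (metis PowD subsetD subsetI subset_antisym)
qed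

lemma pick_image_ksubsets:
  assumes "nform n F"
  shows "pick S ` F \<in> ksubsets n (card F)"
proof -
  have "card (pick S ` F) = card F"
    using inj_on_pick[OF assms] by (rule card_image)
  moreover have "pick S ` F \<subseteq> {1..n}"
  proof (rule image_subsetI)
    fix f assume "f \<in> F"
    then show "pick S f \<in> {1..n}"
      using nformD(2-4)[OF assms, of f] by (simp add: pick_def)
  qed
  ultimately show ?thesis by (simp add: ksubsets_def)
qed

section \<open>Monomials and coefficients of a product of factors\<close>

lemma lookup_expo: "finite T \<Longrightarrow> Poly_Mapping.lookup (expo T) i = (if i \<in> T then 1 else 0)"
  by (simp add: expo_def lookup_sum lookup_single when_def)

lemma expo_eq_iff: "finite S \<Longrightarrow> finite T \<Longrightarrow> expo S = expo T \<longleftrightarrow> S = T"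
proof
  assume fin: "finite S" "finite T" and eq: "expo S = expo T"
  show "S = T"
  proof (rule set_eqI)
    fix i
    have "Poly_Mapping.lookup (expo S) i = Poly_Mapping.lookup (expo T) i" using eq by simp
    then show "i \<in> S \<longleftrightarrow> i \<in> T" by (simp add: lookup_expo fin split: if_splits)
  qed
qed simp

lemma prod_single:
  fixes a :: "'i \<Rightarrow> 'a :: comm_monoid_add" and c :: "'i \<Rightarrow> 'b :: comm_semiring_1"
  shows "(\<Prod>f\<in>F. Poly_Mapping.single (a f) (c f)) = Poly_Mapping.single (\<Sum>f\<in>F. a f) (\<Prod>f\<in>F. c f)"
  by (induction F rule: infinite_finite_induct) (simp_all add: mult_single)

lemma poly_of_expansion:
  assumes "nform n F"
  shows "poly_of F = (\<Sum>S\<in>Pow F. Poly_Mapping.single (expo (pick S ` F)) (\<Prod>f\<in>S. fsign f))"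
proof -
  note fin = nformD(1)[OF assms]
  \<comment> \<open>The right-hand variable is written first, so that the subset \<open>S\<close> in
    \<open>prod_add\<close> consists of the factors that contribute it, together with their
    signs.\<close>
  have "poly_of F = (\<Prod>f\<in>F. Poly_Mapping.single (Poly_Mapping.single (hi f) 1) (fsign f)
      + Poly_Mapping.single (Poly_Mapping.single (lo f) 1) 1)"
    by (rule prod.cong) (auto simp: X_def fsign_def single_uminus)
  also have "\<dots> = (\<Sum>S\<in>Pow F.
      (\<Prod>f\<in>S. Poly_Mapping.single (Poly_Mapping.single (hi f) 1) (fsign f)) *
      (\<Prod>f\<in>F - S. Poly_Mapping.single (Poly_Mapping.single (lo f) 1) 1))"
    by (rule prod_add[OF fin])
  also have "\<dots> = (\<Sum>S\<in>Pow F. Poly_Mapping.single (expo (pick S ` F)) (\<Prod>f\<in>S. fsign f))"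
  proof (rule sum.cong[OF refl])
    fix S assume S: "S \<in> Pow F"
    have "expo (pick S ` F) = (\<Sum>f\<in>F. Poly_Mapping.single (pick S f) 1)"
      unfolding expo_def by (simp add: sum.reindex[OF inj_on_pick[OF assms]])
    also have "\<dots> = (\<Sum>f\<in>F - S. Poly_Mapping.single (pick S f) 1) + (\<Sum>f\<in>S. Poly_Mapping.single (pick S f) 1)"
      using S fin by (intro sum.subset_diff) auto
    also have "\<dots> = (\<Sum>f\<in>S. Poly_Mapping.single (hi f) 1) + (\<Sum>f\<in>F - S. Poly_Mapping.single (lo f) 1)"
      by (simp add: pick_def add.commute)
    finally show "(\<Prod>f\<in>S. Poly_Mapping.single (Poly_Mapping.single (hi f) 1) (fsign f)) *
      (\<Prod>f\<in>F - S. Poly_Mapping.single (Poly_Mapping.single (lo f) 1) 1) =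
      Poly_Mapping.single (expo (pick S ` F)) (\<Prod>f\<in>S. fsign f)"
      by (simp add: prod_single mult_single)
  qed
  finally show ?thesis .
qed

text \<open>Distinct choices give distinct monomials because the factors are disjoint, so nothing
  cancels and every coefficient is a product of signs.\<close>

lemma lookup_poly_of:
  assumes "nform n F" "S \<subseteq> F"
  shows "Poly_Mapping.lookup (poly_of F) (expo (pick S ` F)) = (\<Prod>f\<in>S. fsign f)"
proof -
  note fin = nformD(1)[OF assms(1)]
  have "Poly_Mapping.lookup (poly_of F) (expo (pick S ` F)) =
     (\<Sum>S'\<in>Pow F. if S' = S then \<Prod>f\<in>S. fsign f else 0)"
    unfolding poly_of_expansion[OF assms(1)] lookup_sum
  proof (rule sum.cong[OF refl])
    fix S' assume "S' \<in> Pow F"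
    then have "expo (pick S' ` F) = expo (pick S ` F) \<longleftrightarrow> S' = S"
      using fin assms(2) inj_on_eq_iff[OF inj_on_pick_image[OF assms(1)]] by (simp add: expo_eq_iff)
    then show "Poly_Mapping.lookup (Poly_Mapping.single (expo (pick S' ` F)) (\<Prod>f\<in>S'. fsign f)) (expo (pick S ` F)) =
        (if S' = S then \<Prod>f\<in>S. fsign f else 0)"
      by (auto simp: lookup_single when_def)
  qed
  also have "\<dots> = (\<Prod>f\<in>S. fsign f)"
    using fin assms(2) by simp
  finally show ?thesis .
qed

lemma prod_fsign_nz: "(\<Prod>f\<in>S. fsign f) \<noteq> 0"
  by (cases "finite S") (auto simp: fsign_def)

lemma lookup_poly_of_nz:
  assumes "nform n F" "Poly_Mapping.lookup (poly_of F) e \<noteq> 0"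
  obtains S where "S \<subseteq> F" "e = expo (pick S ` F)"
proof -
  from assms obtain S where "S \<in> Pow F"
    "Poly_Mapping.lookup (Poly_Mapping.single (expo (pick S ` F)) (\<Prod>f\<in>S. fsign f)) e \<noteq> 0"
    unfolding poly_of_expansion[OF assms(1)] lookup_sum by (meson sum.not_neutral_contains_not_neutral)
  then show ?thesis using that by (auto simp: lookup_single when_def split: if_splits)
qed

section \<open>Uniqueness of the normal form\<close>

text \<open>The monomials are the transversals of the factors. Two indices of one factor each occur
  in some monomial but never together, which recovers the pairs; the sign of a pair is the ratio of
  two coefficients whose monomials differ at that pair only.\<close>

lemma nform_subset_if_poly_of_eq:
  assumes F: "nform n F" and G: "nform n G" and eq: "poly_of F = poly_of G"
  shows "F \<subseteq> G"
proof
  note finF = nformD(1)[OF F] and finG = nformD(1)[OF G]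
  have transfer: "\<exists>S\<subseteq>G. pick R ` F = pick S ` G" if "R \<subseteq> F" for R
  proof -
    have "Poly_Mapping.lookup (poly_of G) (expo (pick R ` F)) \<noteq> 0"
      using lookup_poly_of[OF F that] eq prod_fsign_nz by metis
    then obtain S where "S \<subseteq> G" "expo (pick R ` F) = expo (pick S ` G)"
      using lookup_poly_of_nz[OF G] by metis
    then have "S \<subseteq> G \<and> pick R ` F = pick S ` G"
      using finF finG by (simp add: expo_eq_iff)
    then show ?thesis ..
  qed
  fix f assume f: "f \<in> F"
  obtain S1 where S1: "S1 \<subseteq> G" "pick {} ` F = pick S1 ` G" using transfer[of "{}"] by blast
  obtain S2 where S2: "S2 \<subseteq> G" "pick {f} ` F = pick S2 ` G" using transfer[of "{f}"] f by blast
  have "lo f \<in> pick S1 ` G" using pick_image_in_iff(1)[OF F f, of "{}"] S1 by simp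
  then obtain g where g: "g \<in> G" "lo f \<in> factor_indices g" by (metis imageE pick_in)
  have "hi f \<in> pick S2 ` G" using pick_image_in_iff(2)[OF F f, of "{f}"] S2 by simp
  then obtain h where h: "h \<in> G" "hi f \<in> factor_indices h" by (metis imageE pick_in)
  have "g = h"
  proof (rule ccontr)
    assume "g \<noteq> h"
    \<comment> \<open>If the endpoints of \<open>f\<close> lay in two factors of \<open>G\<close>,
      the choice \<open>R\<close> would take \<open>lo f\<close> from one and \<open>hi f\<close>
      from the other. No monomial of \<open>poly_of F\<close> contains both.\<close>
    define R where "R = {u \<in> G. hi u = lo f \<or> hi u = hi f}"
    have RG: "R \<subseteq> G" by (auto simp: R_def)
    have in_R: "x \<in> pick R ` G" if "u \<in> G" "x \<in> factor_indices u" "x = lo f \<or> x = hi f" 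
      "lo f \<notin> factor_indices u \<or> hi f \<notin> factor_indices u" for x u
    proof -
      have "pick R u = x"
        using that nformD(3)[OF G that(1)] by (auto simp: pick_def R_def factor_indices_eq)
      then show ?thesis using that by blast
    qed
    have "lo f \<in> pick R ` G" "hi f \<in> pick R ` G"
      using in_R[OF g] in_R[OF h] nformD(5)[OF G g(1) h(1)] \<open>g \<noteq> h\<close> g h by blast+
    moreover have "Poly_Mapping.lookup (poly_of F) (expo (pick R ` G)) \<noteq> 0"
      using lookup_poly_of[OF G RG] eq prod_fsign_nz by metis
    then obtain S where "S \<subseteq> F" "pick R ` G = pick S ` F"
      using lookup_poly_of_nz[OF F] finF finG expo_eq_iff by (metis finite_imageI)
    ultimately show False using pick_image_in_iff[OF F f, of S] by auto
  qed
  then have lohi: "lo g = lo f" "hi g = hi f"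
    using g h nformD(3)[OF F f] nformD(3)[OF G g(1)] by (auto simp: factor_indices_eq)
  have gS: "g \<notin> S1" "g \<in> S2"
    using pick_image_in_iff[OF G g(1)] pick_image_in_iff[OF F f] lohi S1 S2 
    by (metis empty_iff, metis insertI1)
  \<comment> \<open>Passing from the choice \<open>{}\<close> to \<open>{f}\<close> only exchanges
    \<open>lo f\<close> for \<open>hi f\<close>, so in \<open>G\<close> only the choice at
    \<open>g\<close> changes. The coefficients then differ by \<open>fsign g\<close> on one side and
    by \<open>fsign f\<close> on the other.\<close>
  have "S2 = insert g S1"
  proof -
    have "u \<in> S2 \<longleftrightarrow> u \<in> S1" if u: "u \<in> G" "u \<noteq> g" for u
    proof -
      have ne: "hi u \<noteq> lo f" "hi u \<noteq> hi f"
        using nformD(5)[OF G u(1) g(1), of "hi u"] lohi u by (auto simp: factor_indices_eq)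
      have "hi u \<in> pick {f} ` F \<longleftrightarrow> hi u \<in> pick {} ` F"
        using ne by (auto simp: pick_def image_iff)
      then show ?thesis using pick_image_in_iff(2)[OF G u(1)] S1 S2 by metis
    qed
    then show ?thesis using gS S1(1) S2(1) g(1) by blast
  qed
  then have "(\<Prod>f\<in>S2. fsign f) = fsign g * (\<Prod>f\<in>S1. fsign f)"
    using gS S1(1) finG by (simp add: finite_subset)
  moreover have "(\<Prod>f\<in>S1. fsign f) = 1"
    using lookup_poly_of[OF F, of "{}"] lookup_poly_of[OF G S1(1)] S1(2) eq by simp
  moreover have "(\<Prod>f\<in>S2. fsign f) = fsign f"
    using lookup_poly_of[OF F, of "{f}"] lookup_poly_of[OF G S2(1)] S2(2) eq f by simp
  ultimately have "symm g = symm f" by (auto simp: fsign_def split: if_splits)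
  with lohi have "g = f" by (auto intro: prod_eqI)
  with g show "f \<in> G" by simp
qed

section \<open>Normal forms yield positive k-roots\<close>

text \<open>The leading monomial takes every left endpoint and has coefficient 1. Any other monomial
  trades some left endpoints for larger right ones, so the least index of the difference is a left
  endpoint.\<close>

lemma positive_poly_of:
  assumes F: "nform n F"
  shows "positive n (card F) (poly_of F)"
proof -
  note fin = nformD(1)[OF F]
  have "poly_of F \<in> V n (card F)"
    unfolding V_def
    using lookup_poly_of_nz[OF F] pick_image_ksubsets[OF F] by (metis (mono_tags, lifting) image_eqI in_keys_iff mem_Collect_eq subsetI)
  moreover have one: "Poly_Mapping.lookup (poly_of F) (expo (pick {} ` F)) = 1"
    using lookup_poly_of[OF F, of "{}"] by simp
  then have "poly_of F \<noteq> 0" by auto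
  moreover have "mon_less (pick {} ` F) J"
    if J: "J \<in> ksubsets n (card F)" "Poly_Mapping.lookup (poly_of F) (expo J) \<noteq> 0" "J \<noteq> pick {} ` F" for J
  proof -
    have "finite J" using J(1) finite_subset by (fastforce simp: ksubsets_def)
    then obtain S where S: "S \<subseteq> F" "J = pick S ` F"
      using lookup_poly_of_nz[OF F J(2)] fin expo_eq_iff by (metis finite_imageI)
    let ?I = "pick {} ` F" and ?D = "(pick {} ` F - J) \<union> (J - pick {} ` F)"
    have "?D \<noteq> {}" using J(3) by blast
    then have min: "Min ?D \<in> ?D" using \<open>finite J\<close> fin by (intro Min_in) auto
    have "Min ?D \<in> ?I"
    proof (rule ccontr)
      assume "Min ?D \<notin> ?I"
      with min obtain f where f: "f \<in> F" "Min ?D = pick S f" "pick S f \<notin> ?I" using S by auto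
      then have "f \<in> S" by (auto simp: pick_def)
      then have "lo f \<in> ?D" "Min ?D = hi f"
        using f S pick_image_in_iff[OF F f(1)] by (auto simp: pick_def)
      moreover from this have "Min ?D \<le> lo f" using \<open>finite J\<close> fin by (intro Min_le) auto
      ultimately show False using nformD(3)[OF F f(1)] by simp
    qed
    then show ?thesis using J(3) by (auto simp: mon_less_def)
  qed
  ultimately show ?thesis
    unfolding positive_def using one pick_image_ksubsets[OF F, of "{}"]
    by (intro conjI bexI[of _ "pick {} ` F"]) auto
qed

lemma kroot_poly_of:
  assumes F: "nform n F"
  shows "kroot n (card F) (poly_of F)"
proof -
  obtain f where f: "bij_betw f {1..card F} F"
    using ex_bij_betw_nat_finite_1[OF nformD(1)[OF F]] ..
  define i where "i m = (if odd m then lo (f ((m + 1) div 2)) else hi (f (m div 2)))" for m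
  define e where "e m = (if odd m \<or> symm (f (m div 2)) then 1 else - 1 :: rpoly)" for m
  \<comment> \<open>Positions \<open>2 * r - 1\<close> and \<open>2 * r\<close> both belong to
    factor \<open>r\<close>, and \<open>h\<close> maps either of them back to
    \<open>r\<close>.\<close>
  define h where "h m = (m + 1) div 2" for m :: nat
  have h_in: "f (h m) \<in> F" if "m \<in> {1..2 * card F}" for m
  proof -
    have "h m \<in> {1..card F}" using that by (auto simp: h_def)
    then show ?thesis using f bij_betwE by blast
  qed
  have i_h: "i m = (if odd m then lo (f (h m)) else hi (f (h m)))" for m
    by (auto simp: i_def h_def)
  have "inj_on i {1..2 * card F}"
  proof (rule inj_onI)
    fix a b assume a: "a \<in> {1..2 * card F}" and b: "b \<in> {1..2 * card F}" and eq: "i a = i b"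
    have "i a \<in> factor_indices (f (h a))" "i a \<in> factor_indices (f (h b))"
      using eq i_h[of a] i_h[of b] by (auto simp: factor_indices_eq split: if_splits)
    then have fh: "f (h a) = f (h b)" using nformD(5)[OF F h_in[OF a] h_in[OF b]] by blast
    then have "h a = h b"
      by (rule inj_onD[OF bij_betw_imp_inj_on[OF f]]) (use a b in \<open>auto simp: h_def\<close>)
    moreover have "odd a = odd b"
      using eq i_h fh nformD(3)[OF F h_in[OF b]] by (metis less_irrefl)
    ultimately show "a = b" unfolding h_def by presburger
  qed
  moreover have "i ` {1..2 * card F} \<subseteq> {1..n}"
  proof (rule image_subsetI)
    fix m assume "m \<in> {1..2 * card F}"
    then have "1 \<le> lo (f (h m))" "lo (f (h m)) < hi (f (h m))" "hi (f (h m)) \<le> n"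
      using nformD(2-4)[OF F] h_in by blast+
    then show "i m \<in> {1..n}" by (simp add: i_h)
  qed
  moreover have "poly_of F = (\<Prod>r = 1..card F. e (2 * r - 1) * X (i (2 * r - 1)) + e (2 * r) * X (i (2 * r)))"
  proof -
    have "poly_of F = (\<Prod>r = 1..card F. factor_poly (f r))"
      using prod.reindex_bij_betw[OF f, of factor_poly] by simp
    also have "\<dots> = (\<Prod>r = 1..card F. e (2 * r - 1) * X (i (2 * r - 1)) + e (2 * r) * X (i (2 * r)))"
    proof (rule prod.cong[OF refl])
      fix r assume "r \<in> {1..card F}"
      then have "odd (2 * r - 1)" "(2 * r - 1 + 1) div 2 = r" by auto
      then show "factor_poly (f r) = e (2 * r - 1) * X (i (2 * r - 1)) + e (2 * r) * X (i (2 * r))"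
        by (cases "f r") (auto simp: e_def i_def)
    qed
    finally show ?thesis .
  qed
  ultimately show ?thesis
    unfolding kroot_def by (intro exI[of _ i] exI[of _ e]) (auto simp: e_def)
qed

lemma poly_of_in_B:
  assumes F: "nform n F" and "\<not> nf_defect n F"
  shows "poly_of F \<in> B n (card F)"
proof -
  have "G = F" if "nform n G" "poly_of F = poly_of G" for G
    using nform_subset_if_poly_of_eq[OF F that] nform_subset_if_poly_of_eq[OF that(1) F] that(2) by auto
  then have "\<not> has_defect n (card F) (poly_of F)"
    using assms(2) unfolding has_defect_def normal_form_iff by metis
  then show ?thesis
    unfolding B_def using positive_poly_of[OF F] kroot_poly_of[OF F] by simp
qed

section \<open>Nonnegative integer combinations of \<open>B n k\<close>\<close>

text \<open>A sum over an infinite set is 0 by convention, so the sums over \<open>B n k\<close>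
  need this. Only finitely many linear factors have signs 1 or -1 and indices up to
  \<open>n\<close>, hence there are finitely many \<open>k\<close>-fold products.\<close>

lemma finite_B: "finite (B n k)"
proof -
  define T :: "rpoly set" where
    "T = (\<lambda>(a, p, b, q). a * X p + b * X q) ` ({1, - 1} \<times> {1..n} \<times> {1, - 1} \<times> {1..n})"
  have "v \<in> (\<lambda>f. \<Prod>r = 1..k. f r) ` ({1..k} \<rightarrow>\<^sub>E T)" if "kroot n k v" for v
  proof -
    obtain i e where ie: "i ` {1..2 * k} \<subseteq> {1..n}" "\<forall>m\<in>{1..2 * k}. e m \<in> {1, - 1 :: rpoly}"
      "v = (\<Prod>r = 1..k. e (2 * r - 1) * X (i (2 * r - 1)) + e (2 * r) * X (i (2 * r)))"
      using \<open>kroot n k v\<close> unfolding kroot_def by (elim exE conjE) (rule that, assumption+)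
    define f where "f = (\<lambda>r\<in>{1..k}. e (2 * r - 1) * X (i (2 * r - 1)) + e (2 * r) * X (i (2 * r)))"
    have "f r \<in> T" if "r \<in> {1..k}" for r
    proof -
      have "2 * r - 1 \<in> {1..2 * k}" "2 * r \<in> {1..2 * k}" using that by auto
      then have "(e (2 * r - 1), i (2 * r - 1), e (2 * r), i (2 * r)) \<in> {1, - 1} \<times> {1..n} \<times> {1, - 1} \<times> {1..n}"
        using ie by blast
      then show ?thesis unfolding T_def by (rule rev_image_eqI) (use that in \<open>simp add: f_def\<close>)
    qed
    then have "f \<in> {1..k} \<rightarrow>\<^sub>E T" by (auto simp: f_def)
    moreover have "v = (\<Prod>r = 1..k. f r)" by (simp add: ie(3) f_def)
    ultimately show ?thesis by blast
  qed
  then have "B n k \<subseteq> (\<lambda>f. \<Prod>r = 1..k. f r) ` ({1..k} \<rightarrow>\<^sub>E T)" by (auto simp: B_def)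
  moreover have "finite ({1..k} \<rightarrow>\<^sub>E T)" by (intro finite_PiE) (auto simp: T_def)
  ultimately show ?thesis by (meson finite_imageI finite_subset)
qed

text \<open>The coefficients are natural numbers; the denominator \<open>2 ^ k\<close> enters only
  in the final theorem.\<close>

definition cone :: "nat \<Rightarrow> nat \<Rightarrow> rpoly set" where
  "cone n k = {p. \<exists>c :: rpoly \<Rightarrow> nat. p = (\<Sum>b\<in>B n k. of_nat (c b) * b)}"

lemma cone_zero: "0 \<in> cone n k"
  unfolding cone_def by (auto intro!: exI[of _ "\<lambda>_. 0"])

lemma cone_add:
  assumes "p \<in> cone n k" "q \<in> cone n k"
  shows "p + q \<in> cone n k"
proof -
  obtain c d :: "rpoly \<Rightarrow> nat"
    where "p = (\<Sum>b\<in>B n k. of_nat (c b) * b)" "q = (\<Sum>b\<in>B n k. of_nat (d b) * b)"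
    using assms unfolding cone_def by blast
  then have "p + q = (\<Sum>b\<in>B n k. of_nat (c b + d b) * b)"
    by (simp add: sum.distrib distrib_right)
  then show ?thesis unfolding cone_def by (intro CollectI exI[of _ "\<lambda>b. c b + d b"])
qed

lemma cone_sum: "(\<And>x. x \<in> A \<Longrightarrow> f x \<in> cone n k) \<Longrightarrow> (\<Sum>x\<in>A. f x) \<in> cone n k"
  by (induction A rule: infinite_finite_induct) (auto intro: cone_zero cone_add)

lemma cone_sum_list: "(\<And>x. x \<in> set xs \<Longrightarrow> f x \<in> cone n k) \<Longrightarrow> (\<Sum>x\<leftarrow>xs. f x) \<in> cone n k"
  by (induction xs) (auto intro: cone_zero cone_add)

lemma B_in_cone:
  assumes "b \<in> B n k"
  shows "b \<in> cone n k"
proof -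
  have "(\<Sum>b'\<in>B n k. of_nat (if b' = b then 1 else 0) * b') = (\<Sum>b'\<in>B n k. if b' = b then b' else 0)"
    by (rule sum.cong) auto
  also have "\<dots> = b" using assms finite_B by simp
  finally have "b = (\<Sum>b'\<in>B n k. of_nat (if b' = b then 1 else 0) * b')" by simp
  then show ?thesis unfolding cone_def by (intro CollectI exI[of _ "\<lambda>b'. if b' = b then 1 else 0"])
qed

text \<open>Resolving a defect never lowers the sum of the left endpoints; when that sum is unchanged,
  the sum of the products of the endpoints does not grow; when that is unchanged as well, the
  symmetric factors disappear or move to smaller left endpoints.\<close>

definition reduces :: "nat \<Rightarrow> (nfactor set \<times> nfactor set) set" where
  "reduces n = measures [\<lambda>F. \<Sum>f\<in>F. n - lo f, \<lambda>F. \<Sum>f\<in>F. lo f * hi f,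
     \<lambda>F. \<Sum>f\<in>F. if symm f then lo f else 0]"

text \<open>Each measure is a sum over factors, so untouched factors add the same amount to both
  sides and it suffices to compare the rewritten factors.\<close>

lemma reduces_Un:
  assumes "(E, D) \<in> reduces n" "finite C" "finite D" "finite E" "C \<inter> D = {}" "C \<inter> E = {}"
  shows "(C \<union> E, C \<union> D) \<in> reduces n"
  using assms unfolding reduces_def by (auto simp: sum.union_disjoint)

section \<open>Local replacement of factors\<close>

lemma nform_replace:
  assumes F: "nform n F" and D: "D \<subseteq> F" and E: "nform n E"
    and ind: "indices E \<subseteq> indices D \<union> unused n F"
  shows "nform n ((F - D) \<union> E)" "(F - D) \<inter> E = {}"
proof -
  have disj: "factor_indices f \<inter> factor_indices g = {}" if "f \<in> F - D" "g \<in> E" for f g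
  proof -
    have "factor_indices f \<inter> indices D = {}" using nformD(5)[OF F] that(1) D by blast
    moreover have "factor_indices f \<inter> unused n F = {}" using that(1) by (auto simp: unused_def)
    ultimately show ?thesis using ind that(2) by blast
  qed
  show "(F - D) \<inter> E = {}"
    using disj by (fastforce simp: factor_indices_eq)
  show "nform n ((F - D) \<union> E)"
    unfolding nform_def
  proof (intro conjI ballI impI)
    show "finite ((F - D) \<union> E)" using nformD(1)[OF F] nformD(1)[OF E] by simp
    fix f assume f: "f \<in> (F - D) \<union> E"
    show "1 \<le> lo f" "lo f < hi f" "hi f \<le> n"
      using f nformD(2-4)[OF F, of f] nformD(2-4)[OF E, of f] by auto
    fix g assume g: "g \<in> (F - D) \<union> E" "f \<noteq> g"
    show "factor_indices f \<inter> factor_indices g = {}"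
      using f g disj nformD(5)[OF F] nformD(5)[OF E] by blast
  qed
qed

text \<open>A local rewriting rule: the rest of the normal form enters only through
  \<open>U\<close>, the indices that new factors may take up.\<close>

definition resolution :: "nat \<Rightarrow> nat set \<Rightarrow> nfactor set \<Rightarrow> nfactor set list \<Rightarrow> bool" where
  "resolution n U D Es \<longleftrightarrow>
     (\<forall>E\<in>set Es. nform n E \<and> card E = card D \<and> indices E \<subseteq> indices D \<union> U \<and> (E, D) \<in> reduces n) \<and>
     poly_of D = (\<Sum>E\<leftarrow>Es. poly_of E)"

text \<open>The identity for \<open>D\<close> is multiplied by the remaining factors. Each summand
  is then the product of a smaller normal form with equally many factors, to which the induction
  hypothesis \<open>IH\<close> applies.\<close>

lemma resolve:
  assumes F: "nform n F"
    and IH: "\<And>G. nform n G \<Longrightarrow> card G = card F \<Longrightarrow> (G, F) \<in> reduces n \<Longrightarrow> poly_of G \<in> cone n (card F)"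
    and D: "D \<subseteq> F"
    and res: "resolution n (unused n F) D Es"
  shows "poly_of F \<in> cone n (card F)"
proof -
  note fin = nformD(1)[OF F]
  have "poly_of (F - D) * poly_of E \<in> cone n (card F)" if "E \<in> set Es" for E
  proof -
    have E: "nform n E" "card E = card D" "(E, D) \<in> reduces n"
      "indices E \<subseteq> indices D \<union> unused n F"
      using res that unfolding resolution_def by blast+
    note rep = nform_replace[OF F D E(1) E(4)]
    have finE: "finite E" "finite D" using nformD(1)[OF E(1)] fin D finite_subset by auto
    have "card ((F - D) \<union> E) = card F"
      using finE fin rep(2) D E(2) card_mono[OF fin D] by (simp add: card_Un_disjoint card_Diff_subset)
    moreover have "((F - D) \<union> E, (F - D) \<union> D) \<in> reduces n"
      using E(3) fin finE rep(2) by (intro reduces_Un) auto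
    then have "((F - D) \<union> E, F) \<in> reduces n" using D by (simp add: Un_absorb2)
    ultimately have "poly_of ((F - D) \<union> E) \<in> cone n (card F)"
      using rep(1) IH by blast
    then show ?thesis using finE fin rep(2) by (simp add: prod.union_disjoint)
  qed
  then have "(\<Sum>E\<leftarrow>Es. poly_of (F - D) * poly_of E) \<in> cone n (card F)"
    by (rule cone_sum_list)
  also have "(\<Sum>E\<leftarrow>Es. poly_of (F - D) * poly_of E) = poly_of (F - D) * poly_of D"
    using res by (simp add: resolution_def sum_list_const_mult)
  also have "\<dots> = poly_of F" using prod.subset_diff[OF D fin, of factor_poly] by simp
  finally show ?thesis .
qed

section \<open>Resolutions of the four kinds of defect\<close>

lemma nform_pair:
  assumes "1 \<le> a" "a < b" "b \<le> n" "1 \<le> c" "c < d" "d \<le> n" "{a, b} \<inter> {c, d} = {}"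
  shows "nform n {(a, b, x), (c, d, y)}"
  using assms unfolding nform_def by auto

lemma nform_singleton: "1 \<le> a \<Longrightarrow> a < b \<Longrightarrow> b \<le> n \<Longrightarrow> nform n {(a, b, x)}"
  unfolding nform_def by auto

lemma card_pair: "a \<noteq> c \<Longrightarrow> card {(a, b, x), (c, d, y)} = 2"
  by simp

lemma reduces_pair:
  assumes "a \<noteq> c" "a' \<noteq> c'"
  shows "({(a, b, x), (c, d, y)}, {(a', b', x'), (c', d', y')}) \<in> reduces n \<longleftrightarrow>
     n - a + (n - c) < n - a' + (n - c') \<or>
     n - a + (n - c) = n - a' + (n - c') \<and>
       (a * b + c * d < a' * b' + c' * d' \<or>
        a * b + c * d = a' * b' + c' * d' \<and>
          (if x then a else 0) + (if y then c else 0) < (if x' then a' else 0) + (if y' then c' else 0))"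
  using assms by (simp add: reduces_def)

lemma reduces_singleton:
  "({(a, b, x)}, {(a', b', x')}) \<in> reduces n \<longleftrightarrow>
     n - a < n - a' \<or> n - a = n - a' \<and> (a * b < a' * b' \<or> a * b = a' * b' \<and>
       (if x then a else 0) < (if x' then a' else 0))"
  by (simp add: reduces_def)

text \<open>The right side exceeds the left by \<open>(j - i) * (s - r)\<close>.\<close>

lemma crossing_endpoint_product_less:
  fixes i j r s :: nat
  assumes "i < j" "r < s"
  shows "i * s + j * r < i * r + j * s"
proof -
  obtain p q where "j = i + Suc p" "s = r + Suc q" using assms less_iff_Suc_add by auto
  then show ?thesis by (simp add: algebra_simps)
qed

text \<open>The sign of the new factor on \<open>i\<close> and \<open>s\<close> is minus the product
  of the two old signs. The first term raises a left endpoint from \<open>j\<close> to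
  \<open>r\<close>; the second keeps the left endpoints and lowers the sum of endpoint
  products.\<close>

lemma resolve_crossing:
  fixes a b :: bool
  assumes "i < j" "j < r" "r < s" "1 \<le> i" "s \<le> n"
  defines "D \<equiv> {(i, r, a), (j, s, b)}"
    and "Es \<equiv> [{(i, j, a), (r, s, b)}, {(i, s, a \<noteq> b), (j, r, False)}]"
  shows "resolution n U D Es"
proof -
  have "n - r < n - j" using assms(1-5) by simp
  then have "\<forall>E\<in>set Es. nform n E \<and> card E = card D \<and> indices E \<subseteq> indices D \<union> U \<and> (E, D) \<in> reduces n"
    using assms(1-5) crossing_endpoint_product_less[of i j r s] unfolding D_def Es_def
    by (auto simp: card_pair reduces_pair intro!: nform_pair)
  moreover have "poly_of D = (\<Sum>E\<leftarrow>Es. poly_of E)"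
    using assms(1-3) unfolding D_def Es_def by (cases a; cases b) (simp_all add: algebra_simps)
  ultimately show ?thesis unfolding resolution_def ..
qed

text \<open>The first two terms raise a left endpoint from \<open>j\<close> to \<open>r\<close>. The
  third keeps all endpoints, so the last measure decides: the contribution \<open>j\<close> of the
  symmetric inner factor vanishes, and the outer factor adds at most \<open>i < j\<close>.\<close>

lemma resolve_nesting:
  fixes a :: bool
  assumes "i < j" "j < r" "r < s" "1 \<le> i" "s \<le> n"
  defines "D \<equiv> {(i, s, a), (j, r, True)}"
    and "Es \<equiv> [{(i, j, True), (r, s, a)}, {(i, j, False), (r, s, \<not> a)}, {(i, s, \<not> a), (j, r, False)}]"
  shows "resolution n U D Es"
proof -
  have "n - r < n - j" using assms(1-5) by simp
  then have "\<forall>E\<in>set Es. nform n E \<and> card E = card D \<and> indices E \<subseteq> indices D \<union> U \<and> (E, D) \<in> reduces n"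
    using assms(1-5) unfolding D_def Es_def
    by (auto simp: card_pair reduces_pair intro!: nform_pair)
  moreover have "poly_of D = (\<Sum>E\<leftarrow>Es. poly_of E)"
    using assms(1-3) unfolding D_def Es_def by (cases a) (simp_all add: algebra_simps)
  ultimately show ?thesis unfolding resolution_def ..
qed

text \<open>The variable \<open>X j\<close> is subtracted and added. The first term keeps the left
  endpoint and shortens the factor; the second moves the left endpoint up to
  \<open>j\<close>.\<close>

lemma resolve_unused_inside:
  fixes a :: bool
  assumes "i < j" "j < r" "1 \<le> i" "r \<le> n" "j \<in> U"
  defines "D \<equiv> {(i, r, a)}" and "Es \<equiv> [{(i, j, False)}, {(j, r, a)}]"
  shows "resolution n U D Es"
  using assms(1-5) unfolding D_def Es_def resolution_def
  by (auto simp: reduces_singleton intro!: nform_singleton)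

text \<open>The last two terms add up to \<open>2 * X j\<close>. The first term keeps both endpoints
  but is no longer symmetric; the others start at \<open>j > i\<close>.\<close>

lemma resolve_unused_right:
  assumes "i < j" "j < r" "1 \<le> i" "r \<le> n" "r \<in> U"
  defines "D \<equiv> {(i, j, True)}" and "Es \<equiv> [{(i, j, False)}, {(j, r, False)}, {(j, r, True)}]"
  shows "resolution n U D Es"
  using assms(1-5) unfolding D_def Es_def resolution_def
  by (auto simp: reduces_singleton intro!: nform_singleton)

lemma poly_of_in_cone:
  assumes "nform n F"
  shows "poly_of F \<in> cone n (card F)"
proof -
  have "wf (reduces n)" unfolding reduces_def by (rule wf_measures)
  then show ?thesis using assms
  proof (induction F)
    case (less F)
    note F = \<open>nform n F\<close>
    have IH: "poly_of G \<in> cone n (card F)" if "nform n G" "card G = card F" "(G, F) \<in> reduces n" for G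
      using less.IH[OF that(3) that(1)] that(2) by simp
    note bounds = nformD(2,4)[OF F]
    have used: "j \<in> {1..n}" if "j \<in> unused n F" for j using that by (simp add: unused_def)
    show ?case
    proof (cases "nf_defect n F")
      case False
      then show ?thesis using poly_of_in_B[OF F] B_in_cone by blast
    next
      case True
      then consider
          (crossing) i j r s a b where "i < j" "j < r" "r < s" "(i, r, a) \<in> F" "(j, s, b) \<in> F"
        | (nesting) i j r s a where "i < j" "j < r" "r < s" "(i, s, a) \<in> F" "(j, r, True) \<in> F"
        | (unused_inside) i j r a where "i < j" "j < r" "(i, r, a) \<in> F" "j \<in> unused n F"
        | (unused_right) i j r where "i < j" "j < r" "(i, j, True) \<in> F" "r \<in> unused n F"
        unfolding nf_defect_def by (elim disjE exE conjE) auto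
      then show ?thesis
      proof cases
        case crossing
        have b: "1 \<le> i" "s \<le> n" using bounds(1)[OF crossing(4)] bounds(2)[OF crossing(5)] by simp_all
        show ?thesis
          by (rule resolve[OF F IH _ resolve_crossing[OF crossing(1-3) b]])
            (use crossing in auto)
      next
        case nesting
        have b: "1 \<le> i" "s \<le> n" using bounds[OF nesting(4)] by simp_all
        show ?thesis
          by (rule resolve[OF F IH _ resolve_nesting[OF nesting(1-3) b]])
            (use nesting in auto)
      next
        case unused_inside
        have b: "1 \<le> i" "r \<le> n" using bounds[OF unused_inside(3)] by simp_all
        show ?thesis
          by (rule resolve[OF F IH _ resolve_unused_inside[OF unused_inside(1,2) b unused_inside(4)]])
            (use unused_inside in auto)
      next
        case unused_right
        have b: "1 \<le> i" "r \<le> n" using bounds(1)[OF unused_right(3)] used[OF unused_right(4)] by simp_all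
        show ?thesis
          by (rule resolve[OF F IH _ resolve_unused_right[OF unused_right(1,2) b unused_right(4)]])
            (use unused_right in auto)
      qed
    qed
  qed
qed

section \<open>From the reverse lattice condition to a matching\<close>

text \<open>Greedy choice: the largest element of \<open>I\<close> is matched with the largest
  element of \<open>U\<close>, and the condition on tails survives their removal.\<close>

lemma ballot_matching:
  fixes I U :: "nat set"
  assumes "finite I" "finite U" "I \<inter> U = {}"
    and "\<And>t. card (I \<inter> {t..}) \<le> card (U \<inter> {t..})"
  shows "\<exists>m. inj_on m I \<and> m ` I \<subseteq> U \<and> (\<forall>i\<in>I. i < m i)"
  using assms
proof (induction "card I" arbitrary: I U)
  case 0
  then show ?case by simp
next
  case (Suc k)
  define a u where "a = Max I" and "u = Max U"
  have "I \<noteq> {}" using Suc.hyps(2) by auto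
  then have a: "a \<in> I" "\<And>i. i \<in> I \<Longrightarrow> i \<le> a"
    using Suc.prems(1) by (auto simp: a_def)
  \<comment> \<open>The tail condition at \<open>t = a\<close> forces an element of \<open>U\<close>
    at or beyond \<open>a\<close>, so the maximum of \<open>U\<close> exceeds
    \<open>a\<close>.\<close>
  have "card (I \<inter> {a..}) > 0" using a(1) Suc.prems(1) by (auto simp: card_gt_0_iff)
  then have "U \<inter> {a..} \<noteq> {}" using Suc.prems(4)[of a] by auto
  then obtain w where w: "w \<in> U" "a \<le> w" by auto
  then have u: "u \<in> U" "w \<le> u" using Suc.prems(2) by (auto simp: u_def intro: Max_in)
  have "a \<noteq> u" using a(1) u(1) Suc.prems(3) by blast
  then have "a < u" using w(2) u(2) by simp
  \<comment> \<open>For \<open>t \<le> a\<close> both tails lose exactly one element; beyond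
    \<open>a\<close> nothing of \<open>I\<close> remains.\<close>
  have "card ((I - {a}) \<inter> {t..}) \<le> card ((U - {u}) \<inter> {t..})" for t
  proof (cases "t \<le> a")
    case True
    have "(I - {a}) \<inter> {t..} = I \<inter> {t..} - {a}" "(U - {u}) \<inter> {t..} = U \<inter> {t..} - {u}" by auto
    then have "card ((I - {a}) \<inter> {t..}) = card (I \<inter> {t..}) - 1"
      "card ((U - {u}) \<inter> {t..}) = card (U \<inter> {t..}) - 1"
      using True a(1) u(1) \<open>a < u\<close> by (simp_all add: card_Diff_singleton)
    then show ?thesis using Suc.prems(4)[of t] by simp
  next
    case False
    then have "(I - {a}) \<inter> {t..} = {}" using a(2) by (meson Diff_iff atLeast_iff disjoint_iff le_trans)
    then show ?thesis by simp
  qed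
  then have "\<exists>m. inj_on m (I - {a}) \<and> m ` (I - {a}) \<subseteq> U - {u} \<and> (\<forall>i\<in>I - {a}. i < m i)"
    using Suc.hyps(2) Suc.prems(1-3) a(1) by (intro Suc.hyps(1)) auto
  then obtain m where m: "inj_on m (I - {a})" "m ` (I - {a}) \<subseteq> U - {u}" "\<forall>i\<in>I - {a}. i < m i"
    by blast
  have "inj_on (m(a := u)) I"
    using m(1,2) by (auto simp: inj_on_def)
  moreover have "(m(a := u)) ` I \<subseteq> U" "\<forall>i\<in>I. i < (m(a := u)) i"
    using m(2,3) u(1) \<open>a < u\<close> by auto
  ultimately show ?case by blast
qed

lemma count_list_map_upt: "count_list (map f [a..<b]) y = card {x \<in> {a..<b}. f x = y}"
proof -
  have "count_list (map f [a..<b]) y = length (filter (\<lambda>x. f x = y) [a..<b])"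
    by (simp add: count_list_eq_length_filter filter_map o_def eq_commute)
  also have "\<dots> = card {x \<in> {a..<b}. f x = y}"
    using distinct_length_filter[of "[a..<b]"] by (simp add: Int_def Collect_conj_eq[symmetric] conj_commute)
  finally show ?thesis .
qed

text \<open>Elements of \<open>I\<close> carry the letter 2, so positions with letter 1 lie outside
  \<open>I\<close>. Both inclusions point the way the inequality requires.\<close>

lemma reverse_lattice_card_le:
  assumes I: "I \<in> ksubsets n k" and lat: "reverse_lattice_word (label n (xmon I))"
  shows "card (I \<inter> {t..}) \<le> card (({1..n} - I) \<inter> {t..})"
proof -
  define f :: "nat \<Rightarrow> nat" where "f j = (if X j dvd xmon I then 2 else 1)" for j
  \<comment> \<open>The word starts at position 1, so the tails from \<open>t = 0\<close> and
    \<open>t = 1\<close> coincide; for \<open>s > n + 1\<close> the suffix is empty.\<close>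
  define s where "s = max 1 t"
  have In: "I \<subseteq> {1..n}" using I by (simp add: ksubsets_def)
  then have finI: "finite I" using finite_subset by blast
  have dvd: "f j = 2" if "j \<in> I" for j
    using that finI by (simp add: f_def xmon_def dvd_prodI)
  have "suffix (map f [s..<n + 1]) (label n (xmon I))"
  proof (cases "s \<le> n + 1")
    case True
    then have "[1..<n + 1] = [1..<s] @ [s..<n + 1]"
      using upt_add_eq_append[of 1 s "n + 1 - s"] by (simp add: s_def del: upt_Suc)
    then show ?thesis unfolding label_def f_def[symmetric] by (metis map_append suffixI)
  qed simp
  then have le: "card {x \<in> {s..<n + 1}. f x = 2} \<le> card {x \<in> {s..<n + 1}. f x = 1}"
    using lat count_list_map_upt unfolding reverse_lattice_word_def by metis
  have "card (I \<inter> {t..}) \<le> card {x \<in> {s..<n + 1}. f x = 2}"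
    using In dvd by (intro card_mono) (auto simp: s_def)
  also note le
  also have "card {x \<in> {s..<n + 1}. f x = 1} \<le> card (({1..n} - I) \<inter> {t..})"
    using dvd by (intro card_mono) (auto simp: s_def)
  finally show ?thesis .
qed

section \<open>Expansion of the monomial along a matching\<close>

lemma matching_expansion:
  assumes "finite I" "inj_on m I" "m ` I \<subseteq> {1..n} - I" "\<forall>i\<in>I. i < m i" "I \<subseteq> {1..n}"
  shows "2 ^ card I * xmon I \<in> cone n (card I)"
proof -
  \<comment> \<open>\<open>S\<close> collects the \<open>i\<close> whose factor carries the plus
    sign; running over all \<open>S\<close> gives every choice of signs on the matched
    pairs.\<close>
  define F where "F S = (\<lambda>i. (i, m i, i \<in> S)) ` I" for S
  have inj: "inj_on (\<lambda>i. (i, m i, i \<in> S)) I" for S by (rule inj_onI) simp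
  have "poly_of (F S) \<in> cone n (card I)" for S
  proof -
    have "nform n (F S)"
      using assms unfolding nform_def F_def by (auto simp: inj_on_eq_iff)
    moreover have "card (F S) = card I" unfolding F_def by (rule card_image[OF inj])
    ultimately show ?thesis using poly_of_in_cone by metis
  qed
  then have "(\<Sum>S\<in>Pow I. poly_of (F S)) \<in> cone n (card I)" by (rule cone_sum)
  also have "(\<Sum>S\<in>Pow I. poly_of (F S)) =
     (\<Sum>S\<in>Pow I. (\<Prod>i\<in>S. X i + X (m i)) * (\<Prod>i\<in>I - S. X i - X (m i)))"
  proof (rule sum.cong[OF refl])
    fix S assume "S \<in> Pow I"
    have "poly_of (F S) = (\<Prod>i\<in>I. factor_poly (i, m i, i \<in> S))"
      unfolding F_def by (simp add: prod.reindex[OF inj])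
    also have "\<dots> = (\<Prod>i\<in>I - S. factor_poly (i, m i, i \<in> S)) * (\<Prod>i\<in>S. factor_poly (i, m i, i \<in> S))"
      using \<open>S \<in> Pow I\<close> assms(1) by (intro prod.subset_diff) auto
    finally show "poly_of (F S) = (\<Prod>i\<in>S. X i + X (m i)) * (\<Prod>i\<in>I - S. X i - X (m i))"
      by (simp add: mult.commute)
  qed
  \<comment> \<open>Read backwards, the expansion of a product of sums gathers all sign choices; the
    variables \<open>X (m i)\<close> then cancel.\<close>
  also have "\<dots> = (\<Prod>i\<in>I. (X i + X (m i)) + (X i - X (m i)))"
    by (rule prod_add[OF assms(1), symmetric])
  also have "\<dots> = (\<Prod>i\<in>I. 2 * X i)"
    by (rule prod.cong) simp_all
  also have "\<dots> = 2 ^ card I * xmon I"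
    by (simp add: prod.distrib xmon_def)
  finally show ?thesis .
qed

theorem theorem4p8:
  fixes n k :: nat and I :: "nat set"
  assumes "n \<ge> 2" and "2 * k \<le> n"
    and "I \<in> ksubsets n k"
    and "reverse_lattice_word (label n (xmon I))"
  shows "\<exists>c :: rpoly \<Rightarrow> rat.
           (\<forall>b\<in>B n k. \<exists>m :: nat. c b = of_nat m * (1 / 2 ^ k)) \<and>
           xmon I = (\<Sum>b\<in>B n k. const (c b) * b)"
proof -
  have I: "I \<subseteq> {1..n}" "card I = k" using assms(3) by (simp_all add: ksubsets_def)
  then have finI: "finite I" using finite_subset by blast
  have "\<exists>m. inj_on m I \<and> m ` I \<subseteq> {1..n} - I \<and> (\<forall>i\<in>I. i < m i)"
    using reverse_lattice_card_le[OF assms(3,4)] finI by (intro ballot_matching) auto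
  then obtain m where m: "inj_on m I" "m ` I \<subseteq> {1..n} - I" "\<forall>i\<in>I. i < m i"
    by (elim exE conjE)
  have "2 ^ k * xmon I \<in> cone n k"
    using matching_expansion[OF finI m I(1)] I(2) by simp
  then obtain c :: "rpoly \<Rightarrow> nat" where c: "2 ^ k * xmon I = (\<Sum>b\<in>B n k. of_nat (c b) * b)"
    unfolding cone_def by blast
  have const: "const (of_nat a * (1 / 2 ^ k)) = const (1 / 2 ^ k) * of_nat a" for a
    by (simp add: const_def mult_single flip: single_of_nat)
  \<comment> \<open>The case \<open>a = 2 ^ k\<close> of the preceding fact shows that
    \<open>const (1 / 2 ^ k)\<close> inverts the ring element \<open>2 ^ k\<close>.\<close>
  have "const (1 / 2 ^ k) * 2 ^ k = const (1 / 2 ^ k) * of_nat (2 ^ k)" by (simp only: of_nat_power of_nat_numeral)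
  also have "\<dots> = const 1" unfolding const[symmetric] by simp
  finally have "const (1 / 2 ^ k) * 2 ^ k = 1" by (simp add: const_def)
  then have "xmon I = const (1 / 2 ^ k) * (2 ^ k * xmon I)"
    by (simp only: mult.assoc[symmetric] mult_1)
  also have "\<dots> = (\<Sum>b\<in>B n k. const (of_nat (c b) * (1 / 2 ^ k)) * b)"
    unfolding c const sum_distrib_left by (simp only: mult.assoc)
  finally have "xmon I = (\<Sum>b\<in>B n k. const (of_nat (c b) * (1 / 2 ^ k)) * b)" .
  then show ?thesis by (intro exI[of _ "\<lambda>b. of_nat (c b) * (1 / 2 ^ k)"] conjI ballI) (rule exI, rule refl)
qed

end
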